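(* Let $M_G$ be a mixed graph with $n$ vertices, and let $G$ be its underlying graph with $m$ edges, vertex degrees $d_1,\dots,d_n$, maximum degree $\Delta$ and minimum degree $\delta$. Let $\alpha\in[0,1]$ and let $\mathrm{spd}(A_\alpha)$ be the spread of the matrix $A_\alpha$ of $M_G$. Then $$\mathrm{spd}(A_\alpha)\le\sqrt{\frac{2n\alpha^2\sum_{i=1}^n d_i^2+4mn(1-\alpha)^2-8\alpha^2m^2}{n}}.$$ Furthermore, suppose $n\ge3$. If $n$ is even, then $$\mathrm{spd}(A_\alpha)\ge\frac2n\sqrt{\frac{n\alpha^2}{2}(\Delta-\delta)^2+\frac{2n^2\alpha^2}{n-2}\left(\frac{2m}{n}-\frac{\Delta+\delta}{2}\right)^2+2mn(1-\alpha)^2},$$ and if $n$ is odd, then $$\mathrm{spd}(A_\alpha)\ge2\sqrt{\frac{\frac{n\alpha^2}{2}(\Delta-\delta)^2+\frac{2n^2\alpha^2}{n-2}\left(\frac{2m}{n}-\frac{\Delta+\delta}{2}\right)^2+2mn(1-\alpha)^2}{n^2-1}}.$$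
   Context: A mixed graph $M_G=(V,E,A)$ consists of a vertex set $V=\{v_1,\dots,v_n\}$, a set $E$ of undirected edges and a set $A$ of directed edges (arcs). All mixed graphs are finite and simple (no loops, no multiple edges or arcs), so any two distinct vertices are joined by at most one undirected edge or arc. The underlying graph $G$ is the simple undirected graph obtained by forgetting the directions of the arcs; its number of edges $m$ is thus the total number of undirected edges and arcs. The degree $d_i$ of $v_i$ is its degree in $G$, and $D=\mathrm{diag}(d_1,\dots,d_n)$. Let $\omega=\frac{1+i\sqrt3}{2}$. The Hermitian adjacency matrix of the second kind $H^\omega$ is the $n\times n$ matrix with $(v,u)$ entry equal to $\omega$ if there is an arc from $v$ to $u$, $\bar\omega$ if there is an arc from $u$ to $v$, $1$ if $\{v,u\}$ is an undirected edge, and $0$ otherwise. For $\alpha\in[0,1]$, $A_\alpha=\alpha D+(1-\alpha)H^\omega$, a Hermitian matrix with real eigenvalues $\mu_1(A_\alpha)\ge\dots\ge\mu_n(A_\alpha)$. The spread is $\mathrm{spd}(A_\alpha)=\mu_1(A_\alpha)-\mu_n(A_\alpha)$. *)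

theory Defs
  imports "Jordan_Normal_Form.Char_Poly"
    "HOL-Computational_Algebra.Fundamental_Theorem_Algebra"
begin

text \<open>An undirected edge is a two-element set of vertices; the pair \<open>(u, v)\<close> is the arc
  from \<open>u\<close> to \<open>v\<close>.\<close>

locale mixed_graph =
  fixes V :: "'a set" and E :: "'a set set" and A :: "('a \<times> 'a) set"
  assumes finite_V: "finite V"
    and edges: "e \<in> E \<Longrightarrow> \<exists>u v. e = {u, v} \<and> u \<in> V \<and> v \<in> V \<and> u \<noteq> v"
    and arcs: "(u, v) \<in> A \<Longrightarrow> u \<in> V \<and> v \<in> V \<and> u \<noteq> v"
    and arc_not_reversed: "(u, v) \<in> A \<Longrightarrow> (v, u) \<notin> A"
    and arc_not_edge: "(u, v) \<in> A \<Longrightarrow> {u, v} \<notin> E"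

definition underlying_edges :: "'a set set \<Rightarrow> ('a \<times> 'a) set \<Rightarrow> 'a set set" where
  "underlying_edges E A = E \<union> {{u, v} | u v. (u, v) \<in> A}"

definition deg :: "'a set set \<Rightarrow> ('a \<times> 'a) set \<Rightarrow> 'a \<Rightarrow> nat" where
  "deg E A v = card {e \<in> underlying_edges E A. v \<in> e}"

text \<open>In the matrices below the list \<open>vs\<close> enumerates the vertices; since lists are indexed
  from \<open>0\<close>, the vertex \<open>v\<^sub>i\<close> of the usual labelling is \<open>vs ! (i - 1)\<close>.\<close>

definition omega :: complex where
  "omega = (1 + \<i> * complex_of_real (sqrt 3)) / 2"

definition H_omega :: "'a set set \<Rightarrow> ('a \<times> 'a) set \<Rightarrow> 'a list \<Rightarrow> complex mat" where
  "H_omega E A vs = mat (length vs) (length vs) (\<lambda>(i, j).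
     if (vs ! i, vs ! j) \<in> A then omega
     else if (vs ! j, vs ! i) \<in> A then cnj omega
     else if {vs ! i, vs ! j} \<in> E then 1
     else 0)"

definition degree_mat :: "'a set set \<Rightarrow> ('a \<times> 'a) set \<Rightarrow> 'a list \<Rightarrow> complex mat" where
  "degree_mat E A vs = mat (length vs) (length vs) (\<lambda>(i, j).
     if i = j then of_nat (deg E A (vs ! i)) else 0)"

definition A_alpha :: "real \<Rightarrow> 'a set set \<Rightarrow> ('a \<times> 'a) set \<Rightarrow> 'a list \<Rightarrow> complex mat" where
  "A_alpha \<alpha> E A vs = complex_of_real \<alpha> \<cdot>\<^sub>m degree_mat E A vs
     + complex_of_real (1 - \<alpha>) \<cdot>\<^sub>m H_omega E A vs"

text \<open>The \<open>i\<close>-th largest eigenvalue (\<open>1 \<le> i \<le> n\<close>), counted with multiplicity. It is intended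
  for Hermitian matrices, where taking real parts loses nothing: see
  \<open>char_poly_hermitian\<close> below.\<close>

definition eigenvalue_list :: "complex mat \<Rightarrow> real list" where
  "eigenvalue_list M = rev (sorted_list_of_multiset (image_mset Re (proots (char_poly M))))"

definition nth_eigenvalue :: "complex mat \<Rightarrow> nat \<Rightarrow> real" where
  "nth_eigenvalue M i = eigenvalue_list M ! (i - 1)"

definition spread :: "complex mat \<Rightarrow> real" where
  "spread M = nth_eigenvalue M 1 - nth_eigenvalue M (dim_row M)"

lemma hermitian_eigenvalue_real:
  assumes M: "M \<in> carrier_mat n n"
    and herm: "\<And>i j. i < n \<Longrightarrow> j < n \<Longrightarrow> M $$ (j, i) = cnj (M $$ (i, j))"
    and ev: "eigenvalue M k"
  shows "complex_of_real (Re k) = k"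
proof -
  from ev obtain v where "eigenvector M v k"
    by (auto simp: eigenvalue_def)
  with M have v: "dim_vec v = n" "v \<noteq> 0\<^sub>v n" and eq: "M *\<^sub>v v = k \<cdot>\<^sub>v v"
    by (auto simp: eigenvector_def)
  have row: "(\<Sum>j<n. M $$ (i, j) * v $ j) = k * v $ i" if "i < n" for i
  proof -
    have "(M *\<^sub>v v) $ i = (k \<cdot>\<^sub>v v) $ i" by (simp only: eq)
    with that M v(1) show ?thesis
      by (simp add: scalar_prod_def lessThan_atLeast0)
  qed
  define S where "S = (\<Sum>i<n. cnj (v $ i) * v $ i)"
  define Q where "Q = (\<Sum>i<n. \<Sum>j<n. cnj (v $ i) * M $$ (i, j) * v $ j)"
  have Q: "Q = k * S"
    unfolding Q_def S_def sum_distrib_left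
  proof (rule sum.cong[OF refl])
    fix i assume "i \<in> {..<n}"
    then have "k * v $ i = (\<Sum>j<n. M $$ (i, j) * v $ j)" using row by simp
    then have "k * (cnj (v $ i) * v $ i) = cnj (v $ i) * (\<Sum>j<n. M $$ (i, j) * v $ j)"
      by (metis mult.left_commute)
    then show "(\<Sum>j<n. cnj (v $ i) * M $$ (i, j) * v $ j) = k * (cnj (v $ i) * v $ i)"
      by (simp add: sum_distrib_left mult.assoc)
  qed
  have "cnj Q = (\<Sum>i<n. \<Sum>j<n. cnj (v $ j) * M $$ (j, i) * v $ i)"
    unfolding Q_def cnj_sum
  proof (intro sum.cong refl)
    fix i j assume "i \<in> {..<n}" "j \<in> {..<n}"
    then have "cnj (M $$ (i, j)) = M $$ (j, i)" using herm[of i j] by simp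
    then show "cnj (cnj (v $ i) * M $$ (i, j) * v $ j) = cnj (v $ j) * M $$ (j, i) * v $ i"
      by (simp add: mult_ac)
  qed
  also have "\<dots> = Q"
    unfolding Q_def by (rule sum.swap)
  finally have cQ: "cnj Q = Q" .
  have cS: "S = complex_of_real (\<Sum>i<n. (cmod (v $ i))\<^sup>2)"
    unfolding S_def of_real_sum
    by (intro sum.cong refl) (metis complex_norm_square mult.commute)
  obtain i where i: "i < n" "v $ i \<noteq> 0"
    using v by (metis eq_vecI index_zero_vec)
  then have "(\<Sum>i<n. (cmod (v $ i))\<^sup>2) > 0"
    by (intro sum_pos2[where i = i]) auto
  then have "S \<noteq> 0" unfolding cS of_real_eq_0_iff by linarith
  moreover have "cnj S = S" unfolding cS by (rule complex_cnj_complex_of_real)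
  ultimately have "cnj k = k" using cQ Q by simp
  then show ?thesis by (metis Reals_cnj_iff of_real_Re)
qed

lemma char_poly_hermitian:
  assumes M: "M \<in> carrier_mat n n"
    and herm: "\<And>i j. i < n \<Longrightarrow> j < n \<Longrightarrow> M $$ (j, i) = cnj (M $$ (i, j))"
  shows "length (eigenvalue_list M) = n"
    and "char_poly M = (\<Prod>x\<leftarrow>eigenvalue_list M. [:- complex_of_real x, 1:])"
proof -
  note dm = degree_monic_char_poly[OF M]
  then have nz: "char_poly M \<noteq> 0" by auto
  show "length (eigenvalue_list M) = n"
    by (simp add: eigenvalue_list_def dm size_proots_complex flip: size_mset)
  have real: "image_mset (\<lambda>x. [:- complex_of_real (Re x), 1:]) (proots (char_poly M))
      = image_mset (\<lambda>x. [:- x, 1:]) (proots (char_poly M))"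
    using nz by (intro image_mset_cong)
      (simp add: hermitian_eigenvalue_real[OF M herm] eigenvalue_root_char_poly[OF M])
  have "(\<Prod>x\<leftarrow>eigenvalue_list M. [:- complex_of_real x, 1:])
      = prod_mset (image_mset (\<lambda>x. [:- complex_of_real x, 1:]) (mset (eigenvalue_list M)))"
    by (simp flip: prod_mset_prod_list mset_map)
  also have "\<dots> = prod_mset (image_mset (\<lambda>x. [:- x, 1:]) (proots (char_poly M)))"
    using real by (simp add: eigenvalue_list_def image_mset.compositionality o_def)
  also have "\<dots> = char_poly M"
    using complex_poly_decompose_multiset[of "char_poly M"] dm by simp
  finally show "char_poly M = (\<Prod>x\<leftarrow>eigenvalue_list M. [:- complex_of_real x, 1:])" by simp
qed

lemma A_alpha_carrier: "A_alpha \<alpha> E A vs \<in> carrier_mat (length vs) (length vs)"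
  by (simp add: A_alpha_def H_omega_def degree_mat_def)

lemma (in mixed_graph) A_alpha_hermitian:
  assumes "i < length vs" "j < length vs"
  shows "A_alpha \<alpha> E A vs $$ (j, i) = cnj (A_alpha \<alpha> E A vs $$ (i, j))"
  using assms arc_not_reversed
  by (auto simp: A_alpha_def H_omega_def degree_mat_def insert_commute)

end

theory Submission
  imports Defs "Jordan_Normal_Form.Schur_Decomposition"
begin

text \<open>Everything rests on one quantity. For a family \<open>x\<close> of \<open>n\<close> reals let
  \<open>P(x) = n * (\<Sum>i. (x i)\<^sup>2) - (\<Sum>i. x i)\<^sup>2\<close>, which is \<open>n\<^sup>2\<close> times the variance. For the
  eigenvalues \<open>\<mu>\<close> of \<open>A_alpha\<close> the two power sums are the trace and the squared Frobenius norm,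
  and since all nonzero entries of \<open>H_omega\<close> have modulus \<open>1\<close> these depend on the degrees \<open>d\<close>
  only:
  \<open>P(\<mu>) = \<alpha>\<^sup>2 * P(d) + 2 * m * n * (1 - \<alpha>)\<^sup>2\<close>.
  All three inequalities compare \<open>P\<close> with a range.

  The lemma \<open>dispersion_ge_of_two_entries\<close> bounds \<open>P(x)\<close> from below in terms of two chosen
  entries. Applied to the largest and the smallest eigenvalue it gives
  \<open>P(\<mu>) \<ge> n / 2 * spd\<^sup>2\<close>, which is the upper bound on the spread. Applied to the largest and
  the smallest degree it gives \<open>\<alpha>\<^sup>2 * P(d) + 2 * m * n * (1 - \<alpha>)\<^sup>2 \<ge> T\<close>, where \<open>T\<close> is the
  radicand of the lower bounds.

  The lemma \<open>dispersion_le_range\<close> is Popoviciu's inequality in the sharp form that takes the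
  parity of \<open>n\<close> into account: \<open>P(\<mu>) \<le> \<lfloor>n\<^sup>2 / 4\<rfloor> * spd\<^sup>2\<close>. Together with \<open>P(\<mu>) \<ge> T\<close> this
  is the lower bound on the spread; the floor is \<open>n\<^sup>2 / 4\<close> for even and \<open>(n\<^sup>2 - 1) / 4\<close> for
  odd \<open>n\<close>, whence the two cases.\<close>

section \<open>Dispersion of finite families of reals\<close>

lemma sum_pairwise_diff_squares:
  fixes x :: "'b \<Rightarrow> real"
  shows "(\<Sum>i\<in>I. \<Sum>j\<in>I. (x i - x j)\<^sup>2) = 2 * (real (card I) * (\<Sum>i\<in>I. (x i)\<^sup>2) - (\<Sum>i\<in>I. x i)\<^sup>2)"
proof -
  have "(\<Sum>i\<in>I. \<Sum>j\<in>I. (x i - x j)\<^sup>2)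
      = (\<Sum>i\<in>I. real (card I) * (x i)\<^sup>2 + (\<Sum>j\<in>I. (x j)\<^sup>2) - 2 * (x i * (\<Sum>j\<in>I. x j)))"
    by (simp add: power2_diff sum.distrib sum_subtractf sum_distrib_left mult.assoc)
  also have "\<dots> = real (card I) * (\<Sum>i\<in>I. (x i)\<^sup>2) + real (card I) * (\<Sum>i\<in>I. (x i)\<^sup>2)
      - 2 * ((\<Sum>i\<in>I. x i) * (\<Sum>i\<in>I. x i))"
    by (simp add: sum.distrib sum_subtractf flip: sum_distrib_left sum_distrib_right)
  finally show ?thesis by (simp add: power2_eq_square)
qed

lemma sum_squared_le_card_sum_squares:
  fixes x :: "'b \<Rightarrow> real"
  shows "(\<Sum>i\<in>I. x i)\<^sup>2 \<le> real (card I) * (\<Sum>i\<in>I. (x i)\<^sup>2)"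
proof -
  have "0 \<le> (\<Sum>i\<in>I. \<Sum>j\<in>I. (x i - x j)\<^sup>2)" by (intro sum_nonneg) simp
  then show ?thesis unfolding sum_pairwise_diff_squares by simp
qed

text \<open>Replacing the entries other than \<open>x p\<close> and \<open>x q\<close> by their mean can only decrease the
  right-hand side, by the Cauchy-Schwarz inequality; afterwards only \<open>x p - x q\<close>,
  \<open>x p + x q\<close> and the total sum matter, and the bound is an identity. For \<open>n = 2\<close> there are no
  other entries; then the mean of the family equals \<open>(x p + x q) / 2\<close>, so the second summand
  vanishes whatever value the division by \<open>n - 2\<close> has.\<close>

lemma dispersion_ge_of_two_entries:
  fixes x :: "'b \<Rightarrow> real"
  assumes I: "finite I" "p \<in> I" "q \<in> I" "p \<noteq> q" and n: "n = real (card I)"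
  shows "n / 2 * (x p - x q)\<^sup>2 + 2 * n\<^sup>2 / (n - 2) * ((\<Sum>i\<in>I. x i) / n - (x p + x q) / 2)\<^sup>2
    \<le> n * (\<Sum>i\<in>I. (x i)\<^sup>2) - (\<Sum>i\<in>I. x i)\<^sup>2"
proof -
  define J where "J = I - {p, q}"
  define k where "k = real (card J)"
  define R where "R = (\<Sum>i\<in>J. x i)"
  define Q where "Q = (\<Sum>i\<in>J. (x i)\<^sup>2)"
  define s where "s = x p + x q"
  have J: "I = insert p (insert q J)" "finite J" "p \<notin> insert q J" "q \<notin> J"
    using I by (auto simp: J_def)
  have nk: "n = k + 2" unfolding n k_def J(1) using J(2-4) by simp
  have R: "(\<Sum>i\<in>I. x i) = s + R" unfolding J(1) R_def s_def using J(2-4) by simp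
  have Q: "(\<Sum>i\<in>I. (x i)\<^sup>2) = (x p)\<^sup>2 + (x q)\<^sup>2 + Q" unfolding J(1) Q_def using J(2-4) by simp
  have k0: "k \<ge> 0" by (simp add: k_def)
  have CS: "R\<^sup>2 \<le> k * Q" unfolding R_def Q_def k_def by (rule sum_squared_le_card_sum_squares)
  have sq: "(x p)\<^sup>2 + (x q)\<^sup>2 = (s\<^sup>2 + (x p - x q)\<^sup>2) / 2"
    by (simp add: s_def power2_eq_square algebra_simps)
  have key: "2 * n\<^sup>2 / k * ((s + R) / n - s / 2)\<^sup>2 \<le> n * (s\<^sup>2 / 2 + Q) - (s + R)\<^sup>2"
  proof (cases "k = 0")
    case True
    then have "J = {}" using J(2) by (simp add: k_def)
    then have "R = 0" "Q = 0" by (auto simp: R_def Q_def)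
    with True nk show ?thesis by simp
  next
    case False
    with k0 have k: "k > 0" by simp
    have "n * ((s + R) / n - s / 2) = R - k * s / 2"
      using k nk by (simp add: field_simps)
    then have "n\<^sup>2 * ((s + R) / n - s / 2)\<^sup>2 = (R - k * s / 2)\<^sup>2"
      by (metis power_mult_distrib)
    then have "2 * n\<^sup>2 / k * ((s + R) / n - s / 2)\<^sup>2 = 2 * (R - k * s / 2)\<^sup>2 / k" by simp
    also have "\<dots> = n * (s\<^sup>2 / 2 + R\<^sup>2 / k) - (s + R)\<^sup>2"
      using k by (simp add: nk power2_eq_square field_simps)
    also have "\<dots> \<le> n * (s\<^sup>2 / 2 + Q) - (s + R)\<^sup>2"
    proof -
      have "R\<^sup>2 / k \<le> Q" using CS k by (simp add: field_simps)
      with nk k show ?thesis by (simp add: mult_left_mono)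
    qed
    finally show ?thesis .
  qed
  have "n - 2 = k" using nk by simp
  moreover have "n * ((s\<^sup>2 + (x p - x q)\<^sup>2) / 2 + Q) = n / 2 * (x p - x q)\<^sup>2 + n * (s\<^sup>2 / 2 + Q)"
    by (simp add: field_simps)
  ultimately show ?thesis unfolding R Q sq s_def[symmetric] using key by simp
qed

lemma sum_abs_centered_indices:
  "(\<Sum>i<n. \<bar>real n - 1 - 2 * real i\<bar>) = 2 * real (n\<^sup>2 div 4)"
proof (induction n rule: nat_induct2)
  case (step n)
  define f where "f i = \<bar>real (n + 2) - 1 - 2 * real i\<bar>" for i
  have "(\<Sum>i<n + 2. f i) = f 0 + (\<Sum>i<Suc n. f (Suc i))"
    by (simp only: add_2_eq_Suc' sum.lessThan_Suc_shift)
  also have "\<dots> = 2 * (real n + 1) + (\<Sum>i<n. f (Suc i))"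
    by (simp add: f_def)
  also have "(\<Sum>i<n. f (Suc i)) = (\<Sum>i<n. \<bar>real n - 1 - 2 * real i\<bar>)"
    unfolding f_def by (intro sum.cong refl arg_cong[where f = abs]) simp
  also have "\<dots> = 2 * real (n\<^sup>2 div 4)" by (rule step)
  finally have "(\<Sum>i<n + 2. f i) = 2 * real (n\<^sup>2 div 4 + n + 1)" by simp
  also have "n\<^sup>2 div 4 + n + 1 = (n\<^sup>2 + (n + 1) * 4) div 4" by simp
  also have "n\<^sup>2 + (n + 1) * 4 = (n + 2)\<^sup>2" by (simp add: power2_eq_square)
  finally show ?case unfolding f_def .
qed simp_all

lemma sum_sgn_diff_index:
  assumes "i < n"
  shows "(\<Sum>j<n. sgn (real j - real i)) = real n - 1 - 2 * real i"
proof -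
  have "(\<Sum>j<n. sgn (real j - real i)) = (\<Sum>j<i. sgn (real j - real i)) + (\<Sum>j=i..<n. sgn (real j - real i))"
    using sum.atLeastLessThan_concat[of 0 i n "\<lambda>j. sgn (real j - real i)"] assms
    by (simp add: lessThan_atLeast0)
  also have "(\<Sum>j=i..<n. sgn (real j - real i)) = (\<Sum>j=Suc i..<n. sgn (real j - real i))"
    using assms by (simp add: sum.atLeast_Suc_lessThan)
  also have "(\<Sum>j<i. sgn (real j - real i)) = (\<Sum>j<i. -1)" by (intro sum.cong) auto
  also have "(\<Sum>j=Suc i..<n. sgn (real j - real i)) = (\<Sum>j=Suc i..<n. 1)" by (intro sum.cong) auto
  finally show ?thesis using assms by (simp add: of_nat_diff)
qed

text \<open>Popoviciu's inequality with the sharp constant for each parity. Since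
  \<open>\<bar>x i - x j\<bar> \<le> w\<close> for the range \<open>w\<close>, each term \<open>(x i - x j)\<^sup>2\<close> is at most
  \<open>w * \<bar>x i - x j\<bar>\<close>, so only one of the two factors is estimated. Because \<open>x\<close> is
  decreasing, the sum of all \<open>\<bar>x i - x j\<bar>\<close> is the linear expression
  \<open>2 * (\<Sum>i<n. (n - 1 - 2 * i) * x i)\<close>. Its coefficients add up to \<open>0\<close>, so the \<open>x i\<close> may be
  measured from the midpoint of the range, where their absolute value is at most \<open>w / 2\<close>.
  The constant \<open>\<lfloor>n\<^sup>2 / 4\<rfloor>\<close> is half the sum of the \<open>\<bar>n - 1 - 2 * i\<bar>\<close>.\<close>

lemma dispersion_le_range:
  fixes x :: "nat \<Rightarrow> real"
  assumes dec: "\<And>i j. i \<le> j \<Longrightarrow> j < n \<Longrightarrow> x j \<le> x i"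
  shows "real n * (\<Sum>i<n. (x i)\<^sup>2) - (\<Sum>i<n. x i)\<^sup>2 \<le> real (n\<^sup>2 div 4) * (x 0 - x (n - 1))\<^sup>2"
proof -
  define w where "w = x 0 - x (n - 1)"
  define c where "c = (x 0 + x (n - 1)) / 2"
  define s where "s i j = sgn (real j - real i)" for i j
  define r where "r i = real n - 1 - 2 * real i" for i
  have rs: "(\<Sum>j<n. s i j) = r i" if "i < n" for i
    unfolding s_def r_def by (rule sum_sgn_diff_index[OF that])
  have s_anti: "s i j = - s j i" for i j
    by (simp add: s_def sgn_if)
  have w_nonneg: "w \<ge> 0" if "n > 0" using dec[of 0 "n - 1"] that by (simp add: w_def)
  have bounds: "x (n - 1) \<le> x i" "x i \<le> x 0" if "i < n" for i
    using that dec[of i "n - 1"] dec[of 0 i] by auto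
  \<comment> \<open>\<open>s i j\<close> is the sign of \<open>x i - x j\<close>, if that is nonzero, since \<open>x\<close> is decreasing.\<close>
  have le: "(x i - x j)\<^sup>2 \<le> w * (s i j * (x i - x j))" if "i < n" "j < n" for i j
  proof -
    have "s i j * (x i - x j) = \<bar>x i - x j\<bar>"
      using dec[of i j] dec[of j i] that by (auto simp: s_def sgn_if abs_if)
    moreover have "\<bar>x i - x j\<bar> \<le> w"
      using bounds[OF that(1)] bounds[OF that(2)] by (simp add: w_def)
    then have "\<bar>x i - x j\<bar> * \<bar>x i - x j\<bar> \<le> w * \<bar>x i - x j\<bar>" by (rule mult_right_mono) simp
    ultimately show ?thesis by (simp add: power2_eq_square)
  qed
  have swap: "(\<Sum>i<n. \<Sum>j<n. s i j * x j) = - (\<Sum>i<n. \<Sum>j<n. s i j * x i)"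
    by (subst sum.swap, subst s_anti) (simp add: sum_negf)
  have rx: "(\<Sum>i<n. \<Sum>j<n. s i j * x i) = (\<Sum>i<n. r i * x i)"
    by (simp add: rs flip: sum_distrib_right)
  have r0: "(\<Sum>i<n. r i) = 0"
  proof -
    have "(\<Sum>i<n. r i) = (\<Sum>i<n. \<Sum>j<n. s i j)" by (simp add: rs)
    also have "\<dots> = - (\<Sum>i<n. \<Sum>j<n. s i j)"
      by (subst sum.swap, subst s_anti) (simp add: sum_negf)
    finally show ?thesis by (simp add: rs)
  qed
  have centre: "(\<Sum>i<n. r i * x i) \<le> w * real (n\<^sup>2 div 4)"
  proof -
    have "(\<Sum>i<n. r i * x i) = (\<Sum>i<n. r i * (x i - c))"
      using r0 by (simp add: right_diff_distrib sum_subtractf flip: sum_distrib_right)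
    also have "\<dots> \<le> (\<Sum>i<n. \<bar>r i\<bar> * (w / 2))"
    proof (intro sum_mono)
      fix i assume "i \<in> {..<n}"
      then have "\<bar>x i - c\<bar> \<le> w / 2" using bounds[of i] by (simp add: w_def c_def abs_le_iff field_simps)
      then have "\<bar>r i * (x i - c)\<bar> \<le> \<bar>r i\<bar> * (w / 2)" unfolding abs_mult by (rule mult_left_mono) simp
      then show "r i * (x i - c) \<le> \<bar>r i\<bar> * (w / 2)" by linarith
    qed
    also have "\<dots> = w * real (n\<^sup>2 div 4)"
      using sum_abs_centered_indices[of n] unfolding sum_distrib_right[symmetric] r_def by simp
    finally show ?thesis .
  qed
  have "2 * (real n * (\<Sum>i<n. (x i)\<^sup>2) - (\<Sum>i<n. x i)\<^sup>2) = (\<Sum>i<n. \<Sum>j<n. (x i - x j)\<^sup>2)"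
    by (simp add: sum_pairwise_diff_squares)
  also have "\<dots> \<le> (\<Sum>i<n. \<Sum>j<n. w * (s i j * (x i - x j)))"
    by (intro sum_mono le) auto
  also have "\<dots> = w * (2 * (\<Sum>i<n. r i * x i))"
    using swap rx by (simp add: right_diff_distrib sum_subtractf flip: sum_distrib_left)
  also have "\<dots> \<le> w * (2 * (w * real (n\<^sup>2 div 4)))"
  proof (cases "n = 0")
    case False
    with centre w_nonneg show ?thesis by (intro mult_left_mono) auto
  qed simp
  finally show ?thesis by (simp add: w_def power2_eq_square algebra_simps)
qed

section \<open>Power sums of the eigenvalues\<close>

lemma sum_diag_mult_comm:
  fixes X Y :: "'b :: comm_semiring_0 mat"
  assumes "X \<in> carrier_mat n n" "Y \<in> carrier_mat n n"
  shows "(\<Sum>i<n. (X * Y) $$ (i, i)) = (\<Sum>i<n. (Y * X) $$ (i, i))"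
proof -
  have "(\<Sum>i<n. (X * Y) $$ (i, i)) = (\<Sum>i<n. \<Sum>j<n. X $$ (i, j) * Y $$ (j, i))"
    using assms by (simp add: scalar_prod_def lessThan_atLeast0)
  also have "\<dots> = (\<Sum>j<n. \<Sum>i<n. Y $$ (j, i) * X $$ (i, j))"
    by (subst sum.swap) (simp add: mult.commute)
  also have "\<dots> = (\<Sum>i<n. (Y * X) $$ (i, i))"
    using assms by (simp add: scalar_prod_def lessThan_atLeast0)
  finally show ?thesis .
qed

lemma sum_diag_similar:
  fixes B :: "'b :: comm_semiring_1 mat"
  assumes "similar_mat_wit M B P Q" "M \<in> carrier_mat n n"
  shows "(\<Sum>i<n. M $$ (i, i)) = (\<Sum>i<n. B $$ (i, i))"
proof -
  note w = similar_mat_witD2[OF assms(2,1)]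
  have "(\<Sum>i<n. M $$ (i, i)) = (\<Sum>i<n. (P * B * Q) $$ (i, i))" using w(3) by simp
  also have "\<dots> = (\<Sum>i<n. (Q * (P * B)) $$ (i, i))"
    using w by (intro sum_diag_mult_comm) auto
  also have "Q * (P * B) = B" using w by (simp flip: assoc_mult_mat)
  finally show ?thesis .
qed

text \<open>The diagonal sum is invariant under similarity, so \<open>M\<close> can be replaced by its Schur form
  \<open>B\<close>, whose diagonal lists the eigenvalues with multiplicity. As \<open>B\<close> is triangular, the
  diagonal of \<open>B * B\<close> consists of their squares.\<close>

lemma
  fixes M :: "complex mat"
  assumes M: "M \<in> carrier_mat n n" and es: "char_poly M = (\<Prod>e\<leftarrow>es. [:- e, 1:])"
  shows sum_diag_eq_sum_eigenvalues: "(\<Sum>i<n. M $$ (i, i)) = (\<Sum>e\<leftarrow>es. e)"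
    and sum_diag_square_eq_sum_eigenvalues_squared:
      "(\<Sum>i<n. \<Sum>j<n. M $$ (i, j) * M $$ (j, i)) = (\<Sum>e\<leftarrow>es. e\<^sup>2)"
proof -
  obtain B P Q where "schur_decomposition M es = (B, P, Q)" by (metis prod_cases3)
  from schur_decomposition[OF M es this]
  have sim: "similar_mat_wit M B P Q" and tri: "upper_triangular B" and diag: "diag_mat B = es"
    by auto
  have B: "B \<in> carrier_mat n n" using similar_mat_witD2[OF M sim] by auto
  have es': "es = map (\<lambda>i. B $$ (i, i)) [0..<n]" using diag B by (auto simp: diag_mat_def)
  show "(\<Sum>i<n. M $$ (i, i)) = (\<Sum>e\<leftarrow>es. e)"
    using sum_diag_similar[OF sim M] by (simp add: es' sum_list_distinct_conv_sum_set lessThan_atLeast0 o_def)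
  have "similar_mat_wit (M ^\<^sub>m 2) (B ^\<^sub>m 2) P Q" by (rule similar_mat_wit_pow[OF sim])
  moreover have pow2: "X ^\<^sub>m 2 = X * X" if "X \<in> carrier_mat n n" for X :: "complex mat"
    using that by (simp add: numeral_2_eq_2)
  ultimately have "similar_mat_wit (M * M) (B * B) P Q" using M B by simp
  from sum_diag_similar[OF this, of n] M
  have "(\<Sum>i<n. (M * M) $$ (i, i)) = (\<Sum>i<n. (B * B) $$ (i, i))" by simp
  moreover have "(B * B) $$ (i, i) = (B $$ (i, i))\<^sup>2" if "i < n" for i
  proof -
    have "(B * B) $$ (i, i) = (\<Sum>j<n. B $$ (i, j) * B $$ (j, i))"
      using B that by (simp add: scalar_prod_def lessThan_atLeast0)
    also have "\<dots> = (\<Sum>j<n. if j = i then B $$ (i, i) * B $$ (i, i) else 0)"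
    proof (intro sum.cong refl)
      fix j assume "j \<in> {..<n}"
      with that tri B show "B $$ (i, j) * B $$ (j, i) = (if j = i then B $$ (i, i) * B $$ (i, i) else 0)"
        unfolding upper_triangular_def by (cases i j rule: linorder_cases) auto
    qed
    finally show ?thesis using that by (simp add: power2_eq_square)
  qed
  ultimately show "(\<Sum>i<n. \<Sum>j<n. M $$ (i, j) * M $$ (j, i)) = (\<Sum>e\<leftarrow>es. e\<^sup>2)"
    using M by (simp add: es' sum_list_distinct_conv_sum_set lessThan_atLeast0 o_def scalar_prod_def)
qed

lemma
  assumes M: "M \<in> carrier_mat n n"
    and herm: "\<And>i j. i < n \<Longrightarrow> j < n \<Longrightarrow> M $$ (j, i) = cnj (M $$ (i, j))"
  shows hermitian_sum_eigenvalues: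
      "(\<Sum>i<n. eigenvalue_list M ! i) = (\<Sum>i<n. Re (M $$ (i, i)))"
    and hermitian_sum_eigenvalues_squared:
      "(\<Sum>i<n. (eigenvalue_list M ! i)\<^sup>2) = (\<Sum>i<n. \<Sum>j<n. (cmod (M $$ (i, j)))\<^sup>2)"
proof -
  let ?l = "eigenvalue_list M"
  have len: "length ?l = n"
    and cp: "char_poly M = (\<Prod>e\<leftarrow>map complex_of_real ?l. [:- e, 1:])"
    using char_poly_hermitian[OF M herm] by (simp_all add: o_def)
  have nth: "(\<Sum>i<n. f (?l ! i)) = (\<Sum>e\<leftarrow>?l. f e)" for f :: "real \<Rightarrow> real"
    by (simp add: sum_list_sum_nth len lessThan_atLeast0)
  have of_real: "complex_of_real (\<Sum>e\<leftarrow>?l. f e) = (\<Sum>e\<leftarrow>?l. complex_of_real (f e))" for f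
    by (simp add: sum_list_sum_nth)
  have "(\<Sum>i<n. M $$ (i, i)) = complex_of_real (\<Sum>i<n. ?l ! i)"
    using sum_diag_eq_sum_eigenvalues[OF M cp] nth[of "\<lambda>e. e"] of_real[of "\<lambda>e. e"] by (simp add: o_def)
  then show "(\<Sum>i<n. ?l ! i) = (\<Sum>i<n. Re (M $$ (i, i)))"
    by (metis Re_complex_of_real Re_sum)
  have "complex_of_real (\<Sum>i<n. \<Sum>j<n. (cmod (M $$ (i, j)))\<^sup>2) = (\<Sum>i<n. \<Sum>j<n. M $$ (i, j) * M $$ (j, i))"
    unfolding of_real_sum
  proof (intro sum.cong refl)
    fix i j assume "i \<in> {..<n}" "j \<in> {..<n}"
    then show "complex_of_real ((cmod (M $$ (i, j)))\<^sup>2) = M $$ (i, j) * M $$ (j, i)"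
      using herm[of i j] complex_norm_square[of "M $$ (i, j)"] by simp
  qed
  also have "\<dots> = complex_of_real (\<Sum>i<n. (?l ! i)\<^sup>2)"
    using sum_diag_square_eq_sum_eigenvalues_squared[OF M cp] nth[of "\<lambda>e. e\<^sup>2"] of_real[of "\<lambda>e. e\<^sup>2"]
    by (simp add: o_def)
  finally show "(\<Sum>i<n. (?l ! i)\<^sup>2) = (\<Sum>i<n. \<Sum>j<n. (cmod (M $$ (i, j)))\<^sup>2)"
    using of_real_eq_iff by metis
qed

lemma eigenvalue_list_antimono:
  assumes "i \<le> j" "j < length (eigenvalue_list M)"
  shows "eigenvalue_list M ! j \<le> eigenvalue_list M ! i"
proof -
  have "sorted (rev (eigenvalue_list M))"
    by (simp add: eigenvalue_list_def)
  then show ?thesis using assms by (rule sorted_rev_nth_mono)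
qed

section \<open>Degrees and the Frobenius norm of \<open>A_alpha\<close>\<close>

context mixed_graph
begin

lemma finite_underlying_edges: "finite (underlying_edges E A)"
proof (rule finite_subset)
  show "underlying_edges E A \<subseteq> Pow V"
    using edges arcs by (fastforce simp: underlying_edges_def)
qed (simp add: finite_V)

lemma underlying_edgeE:
  assumes "e \<in> underlying_edges E A"
  obtains u v where "e = {u, v}" "u \<in> V" "v \<in> V" "u \<noteq> v"
  using assms edges arcs unfolding underlying_edges_def by blast

text \<open>The handshake lemma, by double counting of incident pairs.\<close>

lemma sum_deg: "(\<Sum>v\<in>V. deg E A v) = 2 * card (underlying_edges E A)"
  unfolding deg_def
proof (rule sum_multicount[OF finite_V finite_underlying_edges], intro ballI)
  fix e assume "e \<in> underlying_edges E A"
  then obtain u v where e: "e = {u, v}" "u \<in> V" "v \<in> V" "u \<noteq> v" by (rule underlying_edgeE)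
  then have "{i \<in> V. i \<in> e} = {u, v}" by auto
  with e(4) show "card {i \<in> V. i \<in> e} = 2" by simp
qed

lemma deg_eq_card_neighbours:
  assumes vs: "distinct vs" "set vs = V" and i: "i < length vs"
  shows "deg E A (vs ! i) = card {j. j < length vs \<and> {vs ! i, vs ! j} \<in> underlying_edges E A}"
proof -
  let ?N = "{j. j < length vs \<and> {vs ! i, vs ! j} \<in> underlying_edges E A}"
  have "bij_betw (\<lambda>j. {vs ! i, vs ! j}) ?N {e \<in> underlying_edges E A. vs ! i \<in> e}"
  proof (rule bij_betwI')
    fix j k assume "j \<in> ?N" "k \<in> ?N"
    then show "({vs ! i, vs ! j} = {vs ! i, vs ! k}) = (j = k)"
      using vs(1) by (auto simp: doubleton_eq_iff nth_eq_iff_index_eq)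
  next
    fix e assume e: "e \<in> {e \<in> underlying_edges E A. vs ! i \<in> e}"
    then obtain u where u: "e = {vs ! i, u}" "u \<in> V"
      by (auto elim!: underlying_edgeE simp: insert_commute)
    from u(2) vs(2) obtain j where "j < length vs" "u = vs ! j" by (metis in_set_conv_nth)
    with e u(1) show "\<exists>j\<in>?N. e = {vs ! i, vs ! j}" by auto
  qed auto
  then show ?thesis unfolding deg_def by (simp add: bij_betw_same_card)
qed

text \<open>Arcs enter the Frobenius norm exactly as undirected edges do, because \<open>omega\<close> has modulus
  \<open>1\<close>; this is why the bounds see only the underlying graph.\<close>

lemma cmod_omega: "cmod omega = 1"
  by (simp add: omega_def cmod_def power_divide)

lemma cmod_H_omega:
  assumes "i < length vs" "j < length vs"
  shows "cmod (H_omega E A vs $$ (i, j))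
    = (if {vs ! i, vs ! j} \<in> underlying_edges E A then 1 else 0)"
  using assms by (auto simp: H_omega_def underlying_edges_def cmod_omega doubleton_eq_iff)

lemma singleton_not_underlying_edge: "{v} \<notin> underlying_edges E A"
  by (auto elim!: underlying_edgeE simp: doubleton_eq_iff)

lemma H_omega_diag:
  assumes "i < length vs"
  shows "H_omega E A vs $$ (i, i) = 0"
  using cmod_H_omega[OF assms assms] singleton_not_underlying_edge[of "vs ! i"] by simp

lemma A_alpha_index:
  assumes "i < length vs" "j < length vs"
  shows "A_alpha \<alpha> E A vs $$ (i, j)
    = (if i = j then complex_of_real (\<alpha> * real (deg E A (vs ! i)))
       else complex_of_real (1 - \<alpha>) * H_omega E A vs $$ (i, j))"
proof -
  have "H_omega E A vs \<in> carrier_mat (length vs) (length vs)"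
    "degree_mat E A vs \<in> carrier_mat (length vs) (length vs)"
    by (simp_all add: H_omega_def degree_mat_def)
  then have "A_alpha \<alpha> E A vs $$ (i, j) = complex_of_real \<alpha> * degree_mat E A vs $$ (i, j)
      + complex_of_real (1 - \<alpha>) * H_omega E A vs $$ (i, j)"
    using assms by (simp add: A_alpha_def)
  then show ?thesis using assms H_omega_diag[of j vs] by (auto simp: degree_mat_def)
qed

lemma sum_row_cmod_squared_A_alpha:
  assumes vs: "distinct vs" "set vs = V" and i: "i < length vs"
  shows "(\<Sum>j<length vs. (cmod (A_alpha \<alpha> E A vs $$ (i, j)))\<^sup>2)
    = \<alpha>\<^sup>2 * (real (deg E A (vs ! i)))\<^sup>2 + (1 - \<alpha>)\<^sup>2 * real (deg E A (vs ! i))"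
proof -
  let ?adj = "\<lambda>j. {vs ! i, vs ! j} \<in> underlying_edges E A"
  have "(\<Sum>j<length vs. (cmod (A_alpha \<alpha> E A vs $$ (i, j)))\<^sup>2)
      = (\<Sum>j<length vs. (if j = i then \<alpha>\<^sup>2 * (real (deg E A (vs ! i)))\<^sup>2 else 0)
          + (1 - \<alpha>)\<^sup>2 * (if ?adj j then 1 else 0))"
    using i singleton_not_underlying_edge[of "vs ! i"]
    by (intro sum.cong refl) (auto simp: A_alpha_index cmod_H_omega norm_mult power_mult_distrib simp del: of_real_diff of_real_mult)
  also have "\<dots> = \<alpha>\<^sup>2 * (real (deg E A (vs ! i)))\<^sup>2 + (1 - \<alpha>)\<^sup>2 * (\<Sum>j<length vs. if ?adj j then 1 else 0)"
    using i by (simp add: sum.distrib sum_distrib_left)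
  also have "(\<Sum>j<length vs. if ?adj j then 1 else 0 :: real) = real (deg E A (vs ! i))"
    unfolding deg_eq_card_neighbours[OF vs i] by (simp add: sum.If_cases Int_def)
  finally show ?thesis .
qed

end

section \<open>Bounds on the spread\<close>

theorem theorem3p8:
  fixes V :: "'a set" and E :: "'a set set" and A :: "('a \<times> 'a) set"
    and vs :: "'a list" and n m :: nat and \<alpha> :: real and \<Delta> \<delta> :: nat
  assumes graph: "mixed_graph V E A"
    and enum: "distinct vs" "set vs = V" "n = length vs" "n \<ge> 1"
    and m: "m = card (underlying_edges E A)"
    and \<Delta>: "\<Delta> = Max (deg E A ` V)"
    and \<delta>: "\<delta> = Min (deg E A ` V)"
    and \<alpha>: "0 \<le> \<alpha>" "\<alpha> \<le> 1"
  shows "spread (A_alpha \<alpha> E A vs)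
      \<le> sqrt ((2 * real n * \<alpha>\<^sup>2 * (\<Sum>i<n. (real (deg E A (vs ! i)))\<^sup>2)
               + 4 * real m * real n * (1 - \<alpha>)\<^sup>2 - 8 * \<alpha>\<^sup>2 * (real m)\<^sup>2) / real n)
    \<and> (n \<ge> 3 \<longrightarrow>
        (even n \<longrightarrow>
          spread (A_alpha \<alpha> E A vs)
          \<ge> 2 / real n * sqrt (real n * \<alpha>\<^sup>2 / 2 * (real \<Delta> - real \<delta>)\<^sup>2
              + 2 * (real n)\<^sup>2 * \<alpha>\<^sup>2 / (real n - 2)
                * (2 * real m / real n - (real \<Delta> + real \<delta>) / 2)\<^sup>2
              + 2 * real m * real n * (1 - \<alpha>)\<^sup>2)) \<and>
        (odd n \<longrightarrow>
          spread (A_alpha \<alpha> E A vs)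
          \<ge> 2 * sqrt ((real n * \<alpha>\<^sup>2 / 2 * (real \<Delta> - real \<delta>)\<^sup>2
              + 2 * (real n)\<^sup>2 * \<alpha>\<^sup>2 / (real n - 2)
                * (2 * real m / real n - (real \<Delta> + real \<delta>) / 2)\<^sup>2
              + 2 * real m * real n * (1 - \<alpha>)\<^sup>2) / ((real n)\<^sup>2 - 1))))"
proof -
  interpret mixed_graph V E A by (rule graph)
  let ?M = "A_alpha \<alpha> E A vs"
  define d where "d i = real (deg E A (vs ! i))" for i
  define l where "l = eigenvalue_list ?M"
  define N where "N = real n"
  define P where "P = N * (\<Sum>i<n. (l ! i)\<^sup>2) - (\<Sum>i<n. l ! i)\<^sup>2"
  define w where "w = spread ?M"
  have N: "N \<ge> 1" using enum(4) by (simp add: N_def)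
  have M: "?M \<in> carrier_mat n n" using A_alpha_carrier enum(3) by simp
  have herm: "?M $$ (j, i) = cnj (?M $$ (i, j))" if "i < n" "j < n" for i j
    using that enum(3) by (intro A_alpha_hermitian) auto
  have len: "length l = n" unfolding l_def using M herm by (rule char_poly_hermitian)
  have dec: "l ! j \<le> l ! i" if "i \<le> j" "j < n" for i j
    using eigenvalue_list_antimono[of i j ?M] that len by (simp add: l_def)
  have w: "w = l ! 0 - l ! (n - 1)" using M by (simp add: w_def spread_def nth_eigenvalue_def l_def)
  have w0: "w \<ge> 0" using dec[of 0 "n - 1"] enum(4) by (simp add: w)
  have sum_d: "(\<Sum>i<n. d i) = 2 * real m"
  proof -
    have "(\<Sum>i<n. deg E A (vs ! i)) = (\<Sum>v\<leftarrow>vs. deg E A v)"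
      by (simp add: sum_list_sum_nth enum(3) lessThan_atLeast0)
    also have "\<dots> = (\<Sum>v\<in>V. deg E A v)" using enum by (simp add: sum_list_distinct_conv_sum_set)
    also have "\<dots> = 2 * m" by (simp add: sum_deg m)
    finally show ?thesis unfolding d_def by (metis of_nat_sum of_nat_mult of_nat_numeral)
  qed
  have "(\<Sum>i<n. l ! i) = (\<Sum>i<n. Re (?M $$ (i, i)))"
    unfolding l_def using M herm by (rule hermitian_sum_eigenvalues)
  also have "\<dots> = \<alpha> * (2 * real m)"
    unfolding sum_d[symmetric] sum_distrib_left
    using enum(3) by (intro sum.cong) (auto simp: A_alpha_index d_def)
  finally have sum_l: "(\<Sum>i<n. l ! i) = \<alpha> * (2 * real m)" .
  have "(\<Sum>i<n. (l ! i)\<^sup>2) = (\<Sum>i<n. \<Sum>j<n. (cmod (?M $$ (i, j)))\<^sup>2)"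
    unfolding l_def using M herm by (rule hermitian_sum_eigenvalues_squared)
  also have "\<dots> = (\<Sum>i<n. \<alpha>\<^sup>2 * (d i)\<^sup>2 + (1 - \<alpha>)\<^sup>2 * d i)"
    using sum_row_cmod_squared_A_alpha[OF enum(1,2)] enum(3) by (simp add: d_def)
  also have "\<dots> = \<alpha>\<^sup>2 * (\<Sum>i<n. (d i)\<^sup>2) + (1 - \<alpha>)\<^sup>2 * (2 * real m)"
    unfolding sum_d[symmetric] by (simp add: sum.distrib sum_distrib_left)
  finally have sum_l2: "(\<Sum>i<n. (l ! i)\<^sup>2)
    = \<alpha>\<^sup>2 * (\<Sum>i<n. (d i)\<^sup>2) + (1 - \<alpha>)\<^sup>2 * (2 * real m)" .
  have P: "P = \<alpha>\<^sup>2 * (N * (\<Sum>i<n. (d i)\<^sup>2) - (\<Sum>i<n. d i)\<^sup>2) + 2 * real m * N * (1 - \<alpha>)\<^sup>2"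
    by (simp add: P_def sum_l sum_l2 sum_d power_mult_distrib algebra_simps)
  have P0: "P \<ge> 0"
    using sum_squared_le_card_sum_squares[of "\<lambda>i. l ! i" "{..<n}"] by (simp add: P_def N_def)

  have w_le: "w\<^sup>2 \<le> 2 * P / N"
  proof (cases "n = 1")
    case True
    then show ?thesis using P0 N by (simp add: w)
  next
    case False
    with enum(4) have n2: "n \<ge> 2" by simp
    then have "N / 2 * (l ! 0 - l ! (n - 1))\<^sup>2
        + 2 * N\<^sup>2 / (N - 2) * ((\<Sum>i<n. l ! i) / N - (l ! 0 + l ! (n - 1)) / 2)\<^sup>2 \<le> P"
      unfolding P_def by (intro dispersion_ge_of_two_entries) (auto simp: N_def)
    moreover have "0 \<le> 2 * N\<^sup>2 / (N - 2) * ((\<Sum>i<n. l ! i) / N - (l ! 0 + l ! (n - 1)) / 2)\<^sup>2"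
      using n2 by (simp add: N_def)
    ultimately have "N / 2 * w\<^sup>2 \<le> P" unfolding w by linarith
    then show ?thesis using N by (simp add: field_simps)
  qed
  have "2 * P / N = (2 * N * \<alpha>\<^sup>2 * (\<Sum>i<n. (d i)\<^sup>2) + 4 * real m * N * (1 - \<alpha>)\<^sup>2
      - 8 * \<alpha>\<^sup>2 * (real m)\<^sup>2) / N"
    by (simp add: P sum_d power_mult_distrib algebra_simps)
  with w_le have upper: "w \<le> sqrt ((2 * N * \<alpha>\<^sup>2 * (\<Sum>i<n. (d i)\<^sup>2) + 4 * real m * N * (1 - \<alpha>)\<^sup>2
      - 8 * \<alpha>\<^sup>2 * (real m)\<^sup>2) / N)"
    by (metis real_le_rsqrt)

  define T where "T = N * \<alpha>\<^sup>2 / 2 * (real \<Delta> - real \<delta>)\<^sup>2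
      + 2 * N\<^sup>2 * \<alpha>\<^sup>2 / (N - 2) * (2 * real m / N - (real \<Delta> + real \<delta>) / 2)\<^sup>2
      + 2 * real m * N * (1 - \<alpha>)\<^sup>2"
  have T_le: "T \<le> P" if n3: "n \<ge> 3"
  proof -
    have V: "deg E A ` V \<noteq> {}" "finite (deg E A ` V)" using enum finite_V by auto
    have deg_index: "\<exists>i<n. k = deg E A (vs ! i)" if "k \<in> deg E A ` V" for k
      using that enum(2,3) by (auto simp: in_set_conv_nth)
    obtain p where p: "p < n" "\<Delta> = deg E A (vs ! p)" using deg_index Max_in[OF V(2,1)] \<Delta> by metis
    obtain q0 where q0: "q0 < n" "\<delta> = deg E A (vs ! q0)" using deg_index Min_in[OF V(2,1)] \<delta> by metis
    obtain q where q: "q < n" "q \<noteq> p" "\<delta> = deg E A (vs ! q)"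
    proof (cases "q0 = p")
      \<comment> \<open>A vertex that attains both extremes forces all degrees to be equal, so any other vertex serves.\<close>
      case True
      define q where "q = (if p = 0 then 1 else 0 :: nat)"
      have q: "q < n" "q \<noteq> p" using n3 by (auto simp: q_def)
      then have "deg E A (vs ! q) \<in> deg E A ` V" using enum(2,3) by auto
      then have "\<delta> \<le> deg E A (vs ! q)" "deg E A (vs ! q) \<le> \<Delta>"
        using V(2) by (simp_all add: \<delta> \<Delta>)
      with that q True q0 p show ?thesis by auto
    qed (use q0 that in auto)
    have "N / 2 * (d p - d q)\<^sup>2 + 2 * N\<^sup>2 / (N - 2) * ((\<Sum>i<n. d i) / N - (d p + d q) / 2)\<^sup>2
        \<le> N * (\<Sum>i<n. (d i)\<^sup>2) - (\<Sum>i<n. d i)\<^sup>2"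
      using p q by (intro dispersion_ge_of_two_entries) (auto simp: N_def)
    from mult_left_mono[OF this zero_le_power2[of \<alpha>]]
    show ?thesis unfolding T_def P p(2) q(3) d_def[symmetric] sum_d[symmetric]
      by (simp add: algebra_simps)
  qed
  have P_le: "P \<le> real (n\<^sup>2 div 4) * w\<^sup>2"
    using dispersion_le_range[of n "\<lambda>i. l ! i"] dec unfolding P_def w N_def by blast
  have even: "2 / N * sqrt T \<le> w" if "n \<ge> 3" "even n"
  proof -
    have "real (n\<^sup>2 div 4) = N\<^sup>2 / 4" using that(2) by (auto simp: N_def power_mult_distrib)
    with T_le[OF that(1)] P_le have "T \<le> (N * w / 2)\<^sup>2"
      by (simp add: power_mult_distrib power_divide)
    then have "sqrt T \<le> N * w / 2" using w0 N by (intro real_le_lsqrt) auto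
    then show ?thesis using N by (simp add: field_simps)
  qed
  have odd: "2 * sqrt (T / (N\<^sup>2 - 1)) \<le> w" if "n \<ge> 3" "odd n"
  proof -
    from that(2) obtain k where k: "n = 2 * k + 1" by (auto elim: oddE)
    have "n\<^sup>2 = 4 * (k\<^sup>2 + k) + 1" by (simp add: k power2_eq_square algebra_simps)
    then have "n\<^sup>2 div 4 = k\<^sup>2 + k" by arith
    then have "real (n\<^sup>2 div 4) = real (k\<^sup>2 + k)" by simp
    also have "\<dots> = (N\<^sup>2 - 1) / 4" by (simp add: N_def k power2_eq_square algebra_simps)
    finally have c: "real (n\<^sup>2 div 4) = (N\<^sup>2 - 1) / 4" .
    have "T \<le> (N\<^sup>2 - 1) / 4 * w\<^sup>2" using T_le[OF that(1)] P_le unfolding c by linarith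
    moreover have "N\<^sup>2 - 1 > 0" using that(1) by (simp add: N_def)
    ultimately have "T / (N\<^sup>2 - 1) \<le> (w / 2)\<^sup>2" by (simp add: field_simps)
    then have "sqrt (T / (N\<^sup>2 - 1)) \<le> w / 2" using w0 by (intro real_le_lsqrt) auto
    then show ?thesis by simp
  qed
  show ?thesis using upper even odd unfolding w_def T_def N_def d_def by blast
qed

end
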